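(* Let $n\ge 7$ be an integer and let $t\ge 3$ be the integer with $2^t-1\le n<2^{t+1}-1$. Then the set $F=\{f_0,f_1,\ldots,f_{t-1}\}$ is a Gröbner basis for the ideal $I_n=(g_{n-2},g_{n-1},g_n)$ of $\mathbb Z_2[w_2,w_3]$ with respect to the monomial order $\preceq$, where $g_r$, $f_i$ and $\preceq$ are as defined in the context.
   Context: The polynomials $g_r\in\mathbb Z_2[w_2,w_3]$, $r\ge 0$, are defined by $g_0=1$, $g_1=0$, $g_2=w_2$ and $g_{r+3}=w_2g_{r+1}+w_3g_r$ for $r\ge 0$ (equivalently, $g_r$ is the homogeneous part of degree $r$ in the expansion $(1+w_2+w_3)(g_0+g_1+g_2+\cdots)=1$, where $w_i$ has degree $i$). Write the binary expansion $n-2^t+1=\sum_{j=0}^{t-1}\alpha_j2^j$ with $\alpha_j\in\{0,1\}$, put $s_i=\sum_{j=0}^{i}\alpha_j2^j$ for $0\le i\le t-1$ and $s_{-1}=0$, and define \[f_i=w_3^{\alpha_is_{i-1}}\,g_{n-2+2^i-s_i},\qquad 0\le i\le t-1.\] The order $\preceq$ on monomials is lexicographic with $w_3\prec w_2$: $w_2^{b_1}w_3^{c_1}\preceq w_2^{b_2}w_3^{c_2}$ iff $b_1<b_2$, or $b_1=b_2$ and $c_1\le c_2$. The leading monomial $\mathrm{LM}(p)$ of a nonzero polynomial $p$ is the $\preceq$-largest monomial occurring in $p$. A finite set $F$ of nonzero polynomials is a Gröbner basis for an ideal $I$ if $F$ generates $I$ and for every $p\in I\setminus\{0\}$ there is $f\in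 F$ with $\mathrm{LM}(f)\mid\mathrm{LM}(p)$. *)

theory Defs
  imports
    Complex_Main
    "HOL-Library.Z2"
    "HOL-Library.Product_Plus"
    "HOL-Library.Poly_Mapping"
begin

text \<open>
  The monomial \<open>w\<^sub>2^b w\<^sub>3^c\<close> is encoded by its exponent pair \<open>(b, c)\<close>, so a polynomial over
  \<open>\<int>/2\<close> is a finitely supported function from exponent pairs to \<^typ>\<open>bit\<close>, and
  multiplication of monomials is the componentwise sum of exponent pairs.
\<close>

type_synonym monomial = "nat \<times> nat"

type_synonym Z2_poly = "monomial \<Rightarrow>\<^sub>0 bit"

definition w2 :: Z2_poly where "w2 = Poly_Mapping.single (1, 0) 1"

definition w3 :: Z2_poly where "w3 = Poly_Mapping.single (0, 1) 1"


fun mon_le :: "monomial \<Rightarrow> monomial \<Rightarrow> bool" (infix "\<preceq>" 50) where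
  "(b1, c1) \<preceq> (b2, c2) \<longleftrightarrow> b1 < b2 \<or> (b1 = b2 \<and> c1 \<le> c2)"

definition mon_dvd :: "monomial \<Rightarrow> monomial \<Rightarrow> bool" where
  "mon_dvd m m' \<longleftrightarrow> (\<exists>k. m' = m + k)"

text \<open>\<open>LM 0\<close> is unspecified.\<close>

definition LM :: "Z2_poly \<Rightarrow> monomial" where
  "LM p = (THE m. m \<in> Poly_Mapping.keys p \<and> (\<forall>m' \<in> Poly_Mapping.keys p. m' \<preceq> m))"

lemma LM_greatest:
  assumes "p \<noteq> 0"
  shows "LM p \<in> Poly_Mapping.keys p \<and> (\<forall>m' \<in> Poly_Mapping.keys p. m' \<preceq> LM p)"
proof -
  have ex: "\<exists>m \<in> A. \<forall>m' \<in> A. m' \<preceq> m" if "finite A" "A \<noteq> {}" for A :: "monomial set"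
    using that
  proof (induction rule: finite_ne_induct)
    case (singleton x)
    then show ?case by (cases x) simp
  next
    case (insert x A)
    then obtain m where m: "m \<in> A" "\<forall>m' \<in> A. m' \<preceq> m" by blast
    have tot: "a \<preceq> b \<or> b \<preceq> a" and refl: "a \<preceq> a"
      and tr: "a \<preceq> b \<Longrightarrow> b \<preceq> c \<Longrightarrow> a \<preceq> c" for a b c
      by (cases a; cases b; cases c; auto)+
    show ?case
    proof (cases "x \<preceq> m")
      case True
      with m show ?thesis by auto
    next
      case False
      with tot have "m \<preceq> x" by blast
      have "\<forall>m' \<in> insert x A. m' \<preceq> x"
        using m(2) \<open>m \<preceq> x\<close> refl tr by blast
      then show ?thesis by blast
    qed
  qed
  have anti: "a \<preceq> b \<Longrightarrow> b \<preceq> a \<Longrightarrow> a = b" for a b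
    by (cases a; cases b) auto
  have "\<exists>!m. m \<in> Poly_Mapping.keys p \<and> (\<forall>m' \<in> Poly_Mapping.keys p. m' \<preceq> m)"
    using ex[of "Poly_Mapping.keys p"] assms anti by (metis finite_keys keys_eq_empty)
  then show ?thesis
    unfolding LM_def by (rule theI')
qed


text \<open>The ideal generated by a set: its span in the ring regarded as a module over itself.\<close>

definition ideal_gen :: "'a::comm_ring_1 set \<Rightarrow> 'a set" where
  "ideal_gen = module.span (*)"

lemma module_times: "module ((*) :: 'a \<Rightarrow> 'a \<Rightarrow> 'a::comm_ring_1)"
  by unfold_locales (simp_all add: algebra_simps)

definition is_groebner_basis :: "Z2_poly set \<Rightarrow> Z2_poly set \<Rightarrow> bool" where
  "is_groebner_basis F I \<longleftrightarrow>
     finite F \<and> 0 \<notin> F \<and> ideal_gen F = I \<and>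
     (\<forall>p \<in> I - {0}. \<exists>f \<in> F. mon_dvd (LM f) (LM p))"


fun g_poly :: "nat \<Rightarrow> Z2_poly" where
  "g_poly 0 = 1"
| "g_poly (Suc 0) = 0"
| "g_poly (Suc (Suc 0)) = w2"
| "g_poly (Suc (Suc (Suc r))) = w2 * g_poly (Suc r) + w3 * g_poly r"

text \<open>
  The binary digits of \<open>n - 2^t + 1\<close>, written \<open>n + 1 - 2^t\<close> because subtraction on \<^typ>\<open>nat\<close>
  truncates and \<open>n = 2^t - 1\<close> is allowed.
\<close>

definition \<alpha> :: "nat \<Rightarrow> nat \<Rightarrow> nat \<Rightarrow> nat" where
  "\<alpha> n t j = ((n + 1 - 2 ^ t) div 2 ^ j) mod 2"

lemma binary_expansion:
  assumes "2 ^ t - 1 \<le> n" "n < 2 ^ (t + 1) - 1"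
  shows "n + 1 = 2 ^ t + (\<Sum>j<t. \<alpha> n t j * 2 ^ j)"
proof -
  have *: "(\<Sum>j<k. (m div 2 ^ j mod 2) * 2 ^ j) = m mod 2 ^ k" for m k :: nat
  proof (induction k)
    case (Suc k)
    have "m mod 2 ^ Suc k = 2 ^ k * (m div 2 ^ k mod 2) + m mod 2 ^ k"
      using mod_mult2_eq[of m "2 ^ k" 2] by (simp add: mult.commute)
    with Suc show ?case by simp
  qed simp
  have "(\<Sum>j<t. \<alpha> n t j * 2 ^ j) = (n + 1 - 2 ^ t) mod 2 ^ t"
    unfolding \<alpha>_def by (rule *)
  also have "\<dots> = n + 1 - 2 ^ t"
    using assms by (intro mod_less) simp
  finally show ?thesis
    using assms by simp
qed

text \<open>The index of the partial sums is shifted by one: \<open>s_sum n t (i + 1)\<close> is \<open>s\<^sub>i\<close>, so \<open>s_sum n t 0\<close> is \<open>s\<^sub>-\<^sub>1\<close>.\<close>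

definition s_sum :: "nat \<Rightarrow> nat \<Rightarrow> nat \<Rightarrow> nat" where
  "s_sum n t k = (\<Sum>j<k. \<alpha> n t j * 2 ^ j)"

text \<open>The subtraction does not truncate in the relevant range, as there \<open>s\<^sub>i \<le> n + 1 - 2^t\<close>.\<close>

definition f_poly :: "nat \<Rightarrow> nat \<Rightarrow> nat \<Rightarrow> Z2_poly" where
  "f_poly n t i = w3 ^ (\<alpha> n t i * s_sum n t i) * g_poly (n - 2 + 2 ^ i - s_sum n t (i + 1))"

end

theory Submission
  imports Defs
begin

text \<open>
  With \<open>s = s\<^bsub>k-1\<^esub>\<close> put \<open>P\<^sub>k = g\<^bsub>n-2+2^k-s\<^esub>\<close> and \<open>Q\<^sub>k = w\<^sub>3^s g\<^bsub>n-2-s\<^esub>\<close>. Then \<open>f\<^sub>k\<close> is \<open>P\<^sub>k\<close> or \<open>Q\<^sub>k\<close>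
  according to whether \<open>\<alpha>\<^sub>k\<close> is 0 or 1, and the other member of the pair is also a member of the
  next pair. The Frobenius form \<open>g\<^bsub>r+3q\<^esub> = w\<^sub>2^q g\<^bsub>r+q\<^esub> + w\<^sub>3^q g\<^sub>r\<close> (\<open>q\<close> a power of two) of the
  recurrence relates the new member of the pair \<open>P\<^bsub>k+2\<^esub>, Q\<^bsub>k+2\<^esub>\<close> to \<open>f\<^bsub>k+1\<^esub>\<close> and \<open>f\<^sub>k\<close>. Upwards in \<open>k\<close>,
  this shows that all \<open>f\<^sub>k\<close> lie in \<open>I\<^sub>n\<close>. Downwards, \<open>P\<^sub>t = Q\<^sub>t = 0\<close> forces every \<open>P\<^sub>k\<close> and \<open>Q\<^sub>k\<close> to be
  zero or some \<open>f\<^sub>j\<close> with \<open>j \<ge> k\<close>, so the same relations are the syzygies between neighbouring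
  leading monomials of a staircase, reduced to zero.
\<close>

section \<open>Leading monomials\<close>

lemma Z2_poly_add_self [simp]: "p + p = (0 :: Z2_poly)"
  by (rule poly_mapping_eqI) (simp only: lookup_add lookup_zero add_bit_eq_xor xor_self_eq)

lemma Z2_poly_add_self_left [simp]: "p + (p + q) = (q :: Z2_poly)"
  by (metis Z2_poly_add_self add.assoc add_0)

lemma Z2_poly_uminus [simp]: "- p = (p :: Z2_poly)"
  by (metis Z2_poly_add_self add_eq_0_iff)

lemma w2_power: "w2 ^ b = Poly_Mapping.single (b, 0) 1"
  by (induction b) (simp_all add: w2_def mult_single flip: zero_prod_def)

lemma w3_power: "w3 ^ c = Poly_Mapping.single (0, c) 1"
  by (induction c) (simp_all add: w3_def mult_single flip: zero_prod_def)

lemma w2_w3_power: "w2 ^ b * w3 ^ c = Poly_Mapping.single (b, c) 1"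
  by (simp add: w2_power w3_power mult_single)

text \<open>The only nonzero coefficient is 1, so every polynomial arises from 0 by adding monomials
  one at a time.\<close>

lemma Z2_poly_closure:
  assumes "P 0" "\<And>p b c. P p \<Longrightarrow> P (w2 ^ b * w3 ^ c + p)"
  shows "P p"
proof (induction p rule: update_induct)
  case const
  show ?case by (fact assms(1))
next
  case (update p a k)
  have "Poly_Mapping.update a k p = Poly_Mapping.single a 1 + p"
    using update(1,2)
    by (intro poly_mapping_eqI)
      (auto simp: lookup_update lookup_add lookup_single when_def in_keys_iff)
  then show ?case
    using assms(2)[OF update(3)] w2_w3_power by (metis prod.collapse)
qed

lemma mon_le_antisym: "a \<preceq> b \<Longrightarrow> b \<preceq> a \<Longrightarrow> a = b"
  by (cases a; cases b) auto

lemma mon_le_trans: "a \<preceq> b \<Longrightarrow> b \<preceq> c \<Longrightarrow> a \<preceq> c"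
  by (cases a; cases b; cases c) auto

lemma mon_le_total: "a \<preceq> b \<or> b \<preceq> a"
  by (cases a; cases b) auto

lemma LM_eqI:
  assumes "m \<in> Poly_Mapping.keys p" "\<And>m'. m' \<in> Poly_Mapping.keys p \<Longrightarrow> m' \<preceq> m"
  shows "LM p = m"
  unfolding LM_def using assms by (intro the_equality) (auto intro: mon_le_antisym)

lemma LM_add_less:
  assumes "p \<noteq> 0" "q \<noteq> 0" "LM p \<noteq> LM q" "LM q \<preceq> LM p"
  shows "p + q \<noteq> 0 \<and> LM (p + q) = LM p"
proof -
  note p = LM_greatest[OF assms(1)] and q = LM_greatest[OF assms(2)]
  have "LM p \<notin> Poly_Mapping.keys q"
    using q assms(3,4) mon_le_antisym by blast
  with p have mem: "LM p \<in> Poly_Mapping.keys (p + q)"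
    by (simp add: in_keys_iff lookup_add)
  moreover have "m \<preceq> LM p" if "m \<in> Poly_Mapping.keys (p + q)" for m
    using that keys_add[of p q] p q assms(4) mon_le_trans by blast
  ultimately show ?thesis
    by (auto intro: LM_eqI)
qed

lemma LM_add:
  assumes "p \<noteq> 0" "q \<noteq> 0" "LM p \<noteq> LM q"
  shows "p + q \<noteq> 0 \<and> LM (p + q) \<in> {LM p, LM q}"
  using mon_le_total[of "LM q" "LM p"] LM_add_less[of p q] LM_add_less[of q p] assms
  by (auto simp: add.commute)

text \<open>The largest of pairwise distinct leading monomials cannot be cancelled.\<close>

lemma LM_sum:
  assumes "finite A" "A \<noteq> {}" "\<And>x. x \<in> A \<Longrightarrow> p x \<noteq> 0" "inj_on (\<lambda>x. LM (p x)) A"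
  shows "sum p A \<noteq> 0 \<and> LM (sum p A) \<in> (\<lambda>x. LM (p x)) ` A"
  using assms
proof (induction rule: finite_ne_induct)
  case (insert x A)
  then have IH: "sum p A \<noteq> 0 \<and> LM (sum p A) \<in> (\<lambda>x. LM (p x)) ` A"
    by simp
  moreover have "LM (p x) \<notin> (\<lambda>x. LM (p x)) ` A"
    using insert by auto
  ultimately have "LM (p x) \<noteq> LM (sum p A)" by metis
  with IH LM_add[of "p x" "sum p A"] insert show ?case by auto
qed simp

section \<open>Leading terms isolated by their degree in \<open>w2\<close>\<close>

definition w2_below :: "nat \<Rightarrow> Z2_poly \<Rightarrow> bool" where
  "w2_below b p \<longleftrightarrow> (\<forall>m \<in> Poly_Mapping.keys p. fst m < b)"

text \<open>
  Stronger than having leading monomial \<open>(b, c)\<close>: the other monomials are of lower degree in \<open>w\<^sub>2\<close>.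
\<close>

definition w2_lead :: "Z2_poly \<Rightarrow> nat \<Rightarrow> nat \<Rightarrow> bool" where
  "w2_lead p b c \<longleftrightarrow> w2_below b (p + w2 ^ b * w3 ^ c)"

lemma w2_below_add: "w2_below b p \<Longrightarrow> w2_below b q \<Longrightarrow> w2_below b (p + q)"
  using keys_add[of p q] unfolding w2_below_def by blast

lemma keys_monomial_mult:
  "Poly_Mapping.keys (w2 ^ b * w3 ^ c * p) \<subseteq> (\<lambda>m. (b, c) + m) ` Poly_Mapping.keys p"
proof
  fix x assume "x \<in> Poly_Mapping.keys (w2 ^ b * w3 ^ c * p)"
  then obtain y z where "x = y + z" "y \<in> Poly_Mapping.keys (w2 ^ b * w3 ^ c)"
      "z \<in> Poly_Mapping.keys p"
    using keys_mult by blast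
  moreover from this have "y = (b, c)" by (simp add: w2_w3_power)
  ultimately show "x \<in> (\<lambda>m. (b, c) + m) ` Poly_Mapping.keys p" by blast
qed

lemma w2_lead_mult:
  assumes "w2_lead p b c"
  shows "w2_lead (w2 ^ a * w3 ^ d * p) (a + b) (d + c)"
proof -
  have "w2 ^ a * w3 ^ d * p + w2 ^ (a + b) * w3 ^ (d + c)
      = w2 ^ a * w3 ^ d * (p + w2 ^ b * w3 ^ c)"
    by (simp add: algebra_simps power_add)
  then show ?thesis
    using assms keys_monomial_mult[of a d "p + w2 ^ b * w3 ^ c"]
    unfolding w2_lead_def w2_below_def by fastforce
qed

lemma w2_lead_add: "w2_lead p b c \<Longrightarrow> w2_below b q \<Longrightarrow> w2_lead (p + q) b c"
  using w2_below_add[of b "p + w2 ^ b * w3 ^ c" q] unfolding w2_lead_def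
  by (simp add: ac_simps)

lemma w2_lead_LM:
  assumes "w2_lead p b c"
  shows "p \<noteq> 0" "LM p = (b, c)"
proof -
  define q where "q = p + w2 ^ b * w3 ^ c"
  have q: "fst m < b" if "m \<in> Poly_Mapping.keys q" for m
    using assms that unfolding w2_lead_def w2_below_def q_def by blast
  have p: "p = Poly_Mapping.single (b, c) 1 + q"
    by (simp add: q_def w2_w3_power ac_simps)
  have "Poly_Mapping.lookup q (b, c) = 0"
    using q[of "(b, c)"] by (metis fst_conv in_keys_iff less_irrefl)
  then have mem: "(b, c) \<in> Poly_Mapping.keys p"
    by (simp add: p in_keys_iff lookup_add)
  then show "p \<noteq> 0" by auto
  show "LM p = (b, c)"
  proof (rule LM_eqI[OF mem])
    fix m assume "m \<in> Poly_Mapping.keys p"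
    then have "m = (b, c) \<or> m \<in> Poly_Mapping.keys q"
      using keys_add[of "Poly_Mapping.single (b, c) 1" q] unfolding p by auto
    then show "m \<preceq> (b, c)"
      using q by (cases m) auto
  qed
qed

section \<open>Staircases\<close>

text \<open>The monomial multiples of \<open>f j\<close> that reach only \<open>w\<^sub>2\<close>-degrees below the previous corner \<open>B (j - 1)\<close>.\<close>

definition stair_dom :: "(nat \<Rightarrow> nat) \<Rightarrow> nat \<Rightarrow> (nat \<times> nat \<times> nat) set" where
  "stair_dom B m = {(j, a, c). j \<le> m \<and> (0 < j \<longrightarrow> B j + a < B (j - 1))}"

definition stair_term :: "(nat \<Rightarrow> Z2_poly) \<Rightarrow> nat \<times> nat \<times> nat \<Rightarrow> Z2_poly" where
  "stair_term f = (\<lambda>(j, a, c). w2 ^ a * w3 ^ c * f j)"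

text \<open>Over the two-element field subset sums are all the linear combinations, so no
  coefficients are recorded.\<close>

definition stair_span :: "(nat \<Rightarrow> Z2_poly) \<Rightarrow> (nat \<Rightarrow> nat) \<Rightarrow> nat \<Rightarrow> Z2_poly set" where
  "stair_span f B m = {sum (stair_term f) A | A. finite A \<and> A \<subseteq> stair_dom B m}"

lemma stair_span_0: "0 \<in> stair_span f B m"
  unfolding stair_span_def by (auto intro: exI[of _ "{}"])

lemma stair_span_base: "x \<in> stair_dom B m \<Longrightarrow> stair_term f x \<in> stair_span f B m"
  unfolding stair_span_def by (auto intro!: exI[of _ "{x}"])

text \<open>Indices common to both sums cancel in characteristic two, which leaves the sum over the
  symmetric difference.\<close>

lemma stair_span_add:
  assumes "p \<in> stair_span f B m" "q \<in> stair_span f B m"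
  shows "p + q \<in> stair_span f B m"
proof -
  obtain A A' where A: "p = sum (stair_term f) A" "finite A" "A \<subseteq> stair_dom B m"
    and A': "q = sum (stair_term f) A'" "finite A'" "A' \<subseteq> stair_dom B m"
    using assms unfolding stair_span_def by blast
  let ?s = "sum (stair_term f)"
  have "p = ?s (A - A') + ?s (A \<inter> A')" "q = ?s (A' - A) + ?s (A \<inter> A')"
    using sum.Int_Diff[of A "stair_term f" A'] sum.Int_Diff[of A' "stair_term f" A] A A'
    by (simp_all add: ac_simps)
  then have "p + q = ?s (A - A') + ?s (A' - A)"
    by (simp add: ac_simps)
  moreover have "?s (A - A') + ?s (A' - A) = ?s ((A - A') \<union> (A' - A))"
    using A A' by (intro sum.union_disjoint[symmetric]) auto
  moreover have "finite ((A - A') \<union> (A' - A))" "(A - A') \<union> (A' - A) \<subseteq> stair_dom B m"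
    using A A' by auto
  ultimately show ?thesis
    unfolding stair_span_def by auto
qed

lemma stair_span_sum:
  assumes "\<And>x. x \<in> A \<Longrightarrow> p x \<in> stair_span f B m"
  shows "sum p A \<in> stair_span f B m"
  using assms by (induction A rule: infinite_finite_induct)
    (auto intro: stair_span_0 stair_span_add)

lemma stair_span_mult_closed:
  assumes "\<And>x. x \<in> stair_dom B m \<Longrightarrow> r * stair_term f x \<in> stair_span f B m"
    and "p \<in> stair_span f B m"
  shows "r * p \<in> stair_span f B m"
proof -
  obtain A where "p = sum (stair_term f) A" "A \<subseteq> stair_dom B m"
    using assms(2) unfolding stair_span_def by blast
  then show ?thesis
    using assms(1) by (auto simp: sum_distrib_left intro!: stair_span_sum)
qed

lemma stair_span_w3: "p \<in> stair_span f B m \<Longrightarrow> w3 ^ c * p \<in> stair_span f B m"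
proof (erule stair_span_mult_closed[rotated])
  fix x assume x: "x \<in> stair_dom B m"
  obtain j a d where [simp]: "x = (j, a, d)" by (cases x)
  have "w3 ^ c * stair_term f x = stair_term f (j, a, c + d)"
    by (simp add: stair_term_def power_add ac_simps)
  also have "\<dots> \<in> stair_span f B m"
    using x by (intro stair_span_base) (simp add: stair_dom_def)
  finally show "w3 ^ c * stair_term f x \<in> stair_span f B m" .
qed

text \<open>
  In two variables the syzygies of neighbouring corners of the staircase suffice. If they hold,
  the \<^term>\<open>stair_term f\<close> indexed by \<^term>\<open>stair_dom B m\<close> span the ideal over \<open>\<int>/2\<close>
  and have pairwise distinct leading monomials, so leading terms cannot cancel.
\<close>

locale staircase =
  fixes f :: "nat \<Rightarrow> Z2_poly" and B C :: "nat \<Rightarrow> nat" and m :: nat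
  assumes lead: "\<And>i. i \<le> m \<Longrightarrow> w2_lead (f i) (B i) (C i)"
    and desc: "\<And>i. i < m \<Longrightarrow> B (Suc i) < B i"
    and syzygy: "\<And>i. i < m \<Longrightarrow> w2 ^ (B i - B (Suc i)) * f (Suc i) \<in> stair_span f B m"
begin

lemma antimono: "i \<le> j \<Longrightarrow> j \<le> m \<Longrightarrow> B j \<le> B i"
  by (induction j rule: dec_induct) (auto dest!: desc[OF Suc_le_lessD])

lemma stair_term_LM:
  assumes "(j, a, c) \<in> stair_dom B m"
  shows "stair_term f (j, a, c) \<noteq> 0" "LM (stair_term f (j, a, c)) = (a + B j, c + C j)"
  using w2_lead_LM[OF w2_lead_mult[OF lead, of j a c]] assms
  by (simp_all add: stair_dom_def stair_term_def)

text \<open>Index \<open>j\<close> owns the band of \<open>w2\<close>-degrees from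
  \<open>B j\<close> up to but excluding \<open>B (j - 1)\<close>, unbounded above for
  \<open>j = 0\<close>. The bands are disjoint, so the \<open>w2\<close>-degree of a leading
  monomial determines \<open>j\<close>.\<close>

lemma stair_dom_less:
  assumes "(j, a, c) \<in> stair_dom B m" "(j', a', c') \<in> stair_dom B m" "j < j'"
  shows "a' + B j' < a + B j"
proof -
  have "a' + B j' < B (j' - 1)" "B (j' - 1) \<le> B j"
    using assms antimono[of j "j' - 1"] by (auto simp: stair_dom_def)
  then show ?thesis by linarith
qed

lemma inj_on_LM: "inj_on (\<lambda>x. LM (stair_term f x)) (stair_dom B m)"
proof (rule inj_onI)
  fix x y
  assume xy: "x \<in> stair_dom B m" "y \<in> stair_dom B m" "LM (stair_term f x) = LM (stair_term f y)"
  obtain j a c j' a' c' where [simp]: "x = (j, a, c)" "y = (j', a', c')"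
    by (cases x; cases y)
  have "a + B j = a' + B j'" "c + C j = c' + C j'"
    using xy by (simp_all add: stair_term_LM)
  moreover from this have "j = j'"
    using xy stair_dom_less[of j a c j' a' c'] stair_dom_less[of j' a' c' j a c]
    by (cases j j' rule: linorder_cases) auto
  ultimately show "x = y" by simp
qed

lemma stair_span_LM:
  assumes "p \<in> stair_span f B m" "p \<noteq> 0"
  obtains j where "j \<le> m" "mon_dvd (LM (f j)) (LM p)"
proof -
  obtain A where A: "p = sum (stair_term f) A" "finite A" "A \<subseteq> stair_dom B m"
    using assms(1) unfolding stair_span_def by blast
  have "LM p \<in> (\<lambda>x. LM (stair_term f x)) ` A"
    unfolding A(1) using A assms(2) inj_on_subset[OF inj_on_LM A(3)] stair_term_LM(1)
    by (intro LM_sum[THEN conjunct2]) auto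
  then obtain j a c where jac: "(j, a, c) \<in> stair_dom B m" "LM p = LM (stair_term f (j, a, c))"
    using A(3) by auto
  then have "j \<le> m" by (simp add: stair_dom_def)
  moreover have "LM p = LM (f j) + (a, c)"
    using jac stair_term_LM w2_lead_LM[OF lead[OF \<open>j \<le> m\<close>]] by simp
  ultimately show thesis
    using that unfolding mon_dvd_def by blast
qed

text \<open>Raising \<open>a\<close> leaves the band only at its upper edge, and there the product
  is a power of \<open>w3\<close> times the element treated by \<open>syzygy\<close>.\<close>

lemma stair_span_w2: "p \<in> stair_span f B m \<Longrightarrow> w2 * p \<in> stair_span f B m"
proof (erule stair_span_mult_closed[rotated])
  fix x assume x: "x \<in> stair_dom B m"
  obtain j a c where [simp]: "x = (j, a, c)" by (cases x)
  have eq: "w2 * stair_term f x = w3 ^ c * (w2 ^ Suc a * f j)"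
    by (simp add: stair_term_def ac_simps)
  show "w2 * stair_term f x \<in> stair_span f B m"
  proof (cases "(j, Suc a, c) \<in> stair_dom B m")
    case True
    have "w2 * stair_term f x = stair_term f (j, Suc a, c)"
      by (simp add: stair_term_def ac_simps)
    with stair_span_base[OF True] show ?thesis by simp
  next
    case False
    then have "0 < j" using x by (auto simp: stair_dom_def)
    then obtain i where [simp]: "j = Suc i" by (cases j) auto
    have "i < m" "Suc a = B i - B (Suc i)"
      using x False by (auto simp: stair_dom_def)
    then show ?thesis
      unfolding eq using syzygy[of i] by (auto intro: stair_span_w3)
  qed
qed

lemma stair_span_mult:
  assumes "p \<in> stair_span f B m"
  shows "r * p \<in> stair_span f B m"
proof (induction r rule: Z2_poly_closure)
  case 1
  show ?case by (simp add: stair_span_0)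
next
  case (2 r b c)
  have "w2 ^ b * q \<in> stair_span f B m" if "q \<in> stair_span f B m" for q
    by (induction b) (use that stair_span_w2 in \<open>auto simp: mult.assoc\<close>)
  from this[OF stair_span_w3[OF assms]] 2 show ?case
    by (auto simp: distrib_right mult.assoc intro: stair_span_add)
qed

lemma generator_in_stair_span: "j \<le> m \<Longrightarrow> f j \<in> stair_span f B m"
  using stair_span_base[of "(j, 0, 0)" B m f] desc[of "j - 1"]
  by (cases j) (auto simp: stair_dom_def stair_term_def)

lemma ideal_gen_eq: "ideal_gen (f ` {..m}) = stair_span f B m"
proof
  note [intro] = stair_span_0 stair_span_add stair_span_mult generator_in_stair_span
  show "ideal_gen (f ` {..m}) \<subseteq> stair_span f B m"
    unfolding ideal_gen_def
    by (rule module.span_minimal[OF module_times])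
      (auto simp: module.subspace_def[OF module_times])
  show "stair_span f B m \<subseteq> ideal_gen (f ` {..m})"
  proof
    fix p assume "p \<in> stair_span f B m"
    then obtain A where A: "p = sum (stair_term f) A" "A \<subseteq> stair_dom B m"
      unfolding stair_span_def by blast
    show "p \<in> ideal_gen (f ` {..m})"
      unfolding ideal_gen_def A(1)
    proof (rule module.span_sum[OF module_times])
      fix x assume "x \<in> A"
      then obtain j a c where [simp]: "x = (j, a, c)" "j \<le> m"
        using A(2) by (auto simp: stair_dom_def)
      show "stair_term f x \<in> module.span (*) (f ` {..m})"
        using module.span_scale[OF module_times module.span_base[OF module_times, of "f j"],
            of "f ` {..m}" "w2 ^ a * w3 ^ c"]
        by (simp add: stair_term_def)
    qed
  qed
qed

lemma groebner: "is_groebner_basis (f ` {..m}) (ideal_gen (f ` {..m}))"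
  unfolding is_groebner_basis_def
proof (intro conjI ballI)
  show "0 \<notin> f ` {..m}"
    using w2_lead_LM(1)[OF lead] by force
  fix p assume "p \<in> ideal_gen (f ` {..m}) - {0}"
  then obtain j where "j \<le> m" "mon_dvd (LM (f j)) (LM p)"
    using stair_span_LM[of p] unfolding ideal_gen_eq by blast
  then show "\<exists>q \<in> f ` {..m}. mon_dvd (LM q) (LM p)" by blast
qed simp_all

end

section \<open>The polynomials g with shifted index\<close>

text \<open>The shift by three turns \<open>g\<^bsub>2^k-3\<^esub> = 0\<close> into vanishing at the powers of two.\<close>

definition h_poly :: "nat \<Rightarrow> Z2_poly" where
  "h_poly r = (if r < 3 then 0 else g_poly (r - 3))"

text \<open>The padding by zeros respects the recurrence from \<open>r = 1\<close> on; at
  \<open>r = 0\<close> the left-hand side is \<open>h_poly 3 = 1\<close> while the right-hand side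
  vanishes.\<close>

lemma h_poly_rec:
  assumes "0 < r"
  shows "h_poly (r + 3) = w2 * h_poly (r + 1) + w3 * h_poly r"
proof (cases "r < 3")
  case True
  with assms have "r = 1 \<or> r = 2" by auto
  then show ?thesis by (auto simp: h_poly_def numeral_eq_Suc)
next
  case False
  then obtain s where "r = s + 3" by (metis add.commute le_Suc_ex not_less)
  then show ?thesis by (simp add: h_poly_def numeral_eq_Suc)
qed

lemma h_poly_frobenius:
  assumes "0 < r"
  shows "h_poly (r + 3 * 2 ^ i) = w2 ^ (2 ^ i) * h_poly (r + 2 ^ i) + w3 ^ (2 ^ i) * h_poly r"
  using assms
proof (induction i arbitrary: r)
  case 0
  then show ?case using h_poly_rec[of r] by simp
next
  case (Suc i)
  let ?q = "2 ^ i :: nat" and ?h = h_poly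
  have "?h (r + 3 * 2 ^ Suc i) = ?h (r + 3 * ?q + 3 * ?q)"
    by (simp add: algebra_simps)
  also have "\<dots> = w2 ^ ?q * ?h (r + ?q + 3 * ?q) + w3 ^ ?q * ?h (r + 3 * ?q)"
    using Suc.IH[of "r + 3 * ?q"] Suc.prems by (simp add: algebra_simps)
  also have "\<dots> = w2 ^ ?q * (w2 ^ ?q * ?h (r + ?q + ?q) + w3 ^ ?q * ?h (r + ?q))
      + w3 ^ ?q * (w2 ^ ?q * ?h (r + ?q) + w3 ^ ?q * ?h r)"
    using Suc.IH[of "r + ?q"] Suc.IH[of r] Suc.prems by simp
  \<comment> \<open>The two mixed terms in \<open>?h (r + ?q)\<close> coincide and cancel in
    characteristic two.\<close>
  also have "\<dots> = w2 ^ ?q * w2 ^ ?q * ?h (r + ?q + ?q) + w3 ^ ?q * w3 ^ ?q * ?h r"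
    by (simp add: algebra_simps)
  finally show ?case
    by (simp add: mult_2 power_add add.assoc)
qed

text \<open>Since \<open>2^(l+2) = 2^l + 3 * 2^l\<close>, one Frobenius step reduces to the
  exponents \<open>l + 1\<close> and \<open>l\<close>.\<close>

lemma h_poly_power_2: "h_poly (2 ^ k) = 0"
proof (induction k rule: less_induct)
  case (less k)
  show ?case
  proof (cases "k < 2")
    case True
    then have "k = 0 \<or> k = 1" by auto
    then show ?thesis by (auto simp: h_poly_def)
  next
    case False
    then obtain l where l: "k = l + 2" by (metis add.commute le_Suc_ex not_less)
    have "h_poly (2 ^ k) = h_poly (2 ^ l + 3 * 2 ^ l)" by (simp add: l)
    also have "\<dots> = w2 ^ (2 ^ l) * h_poly (2 ^ Suc l) + w3 ^ (2 ^ l) * h_poly (2 ^ l)"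
      by (subst h_poly_frobenius) (simp_all add: mult_2)
    also have "\<dots> = 0" using less.IH[of l] less.IH[of "Suc l"] l by simp
    finally show ?thesis .
  qed
qed

text \<open>With \<open>q = 2^i\<close>, split \<open>6q\<close> as \<open>3q + 3q\<close>: the
  \<open>w2\<close> term of the Frobenius step contains \<open>h_poly\<close> at the power of two
  \<open>4q\<close> and vanishes.\<close>

lemma h_poly_three_times_power_2: "h_poly (3 * 2 ^ i) = w3 ^ (2 ^ i - 1)"
proof (induction i)
  case 0
  show ?case by (simp add: h_poly_def)
next
  case (Suc i)
  have "h_poly (3 * 2 ^ Suc i) = h_poly (3 * 2 ^ i + 3 * 2 ^ i)" by simp
  also have "\<dots> = w2 ^ (2 ^ i) * h_poly (2 ^ (i + 2)) + w3 ^ (2 ^ i) * h_poly (3 * 2 ^ i)"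
    by (subst h_poly_frobenius) simp_all
  also have "\<dots> = w3 ^ (2 ^ i + (2 ^ i - 1))"
    unfolding h_poly_power_2 Suc.IH power_add[of w3] by simp
  finally show ?case by (simp add: mult_2)
qed

text \<open>Homogeneity alone gives \<open>2 * b + 3 \<le> 2^i * k\<close>. The stronger bound comes
  from running the recurrence in strides of \<open>2^i\<close>, starting from zeros at
  \<open>k = 0, 1, 2\<close> and a power of \<open>w3\<close> at \<open>k = 3\<close>.\<close>

lemma h_poly_keys:
  assumes "(b, c) \<in> Poly_Mapping.keys (h_poly (2 ^ i * k))"
  shows "2 * b + 3 * 2 ^ i \<le> 2 ^ i * k"
  using assms
proof (induction k arbitrary: b c rule: less_induct)
  case (less k)
  let ?q = "2 ^ i :: nat"
  consider "k = 0" | "k = 1" | "k = 2" | "k = 3" | "3 < k"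
    by linarith
  then show ?case
  proof cases
    case 5
    define l where "l = k - 3"
    with 5 have l: "k = l + 3" "0 < l" by auto
    have "h_poly (?q * k) =
        w2 ^ ?q * w3 ^ 0 * h_poly (?q * (l + 1)) + w2 ^ 0 * w3 ^ ?q * h_poly (?q * l)"
      using h_poly_frobenius[of "?q * l" i] l by (simp add: algebra_simps)
    then have "(b, c) \<in> (+) (?q, 0) ` Poly_Mapping.keys (h_poly (?q * (l + 1)))
        \<union> (+) (0, ?q) ` Poly_Mapping.keys (h_poly (?q * l))"
      using less.prems keys_add[of "w2 ^ ?q * w3 ^ 0 * h_poly (?q * (l + 1))"]
        keys_monomial_mult[of ?q 0] keys_monomial_mult[of 0 ?q] by (simp only:) blast
    then consider b' c' where "b = ?q + b'" "(b', c') \<in> Poly_Mapping.keys (h_poly (?q * (l + 1)))"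
      | c' where "(b, c') \<in> Poly_Mapping.keys (h_poly (?q * l))" by auto
    then show ?thesis
      using less.IH[of "l + 1"] less.IH[of l] l by cases (fastforce simp: algebra_simps)+
  next
    case 4
    have "h_poly (?q * k) = w2 ^ 0 * w3 ^ (?q - 1)"
      using h_poly_three_times_power_2[of i] 4 by (simp add: mult.commute)
    then show ?thesis
      using less.prems 4 by (simp only: w2_w3_power) simp
  qed (use less.prems h_poly_power_2[of i] h_poly_power_2[of "Suc i"] in
      \<open>auto simp: h_poly_def[of 0] mult.commute\<close>)
qed

text \<open>From one odd multiple of \<open>2^i\<close> to the next, the Frobenius step multiplies
  the leading term by \<open>w2 ^ (2^i)\<close>; \<open>h_poly_keys\<close> keeps the other summand
  below it.\<close>

lemma h_poly_lead: "w2_lead (h_poly (2 ^ i * (2 * k + 3))) (2 ^ i * k) (2 ^ i - 1)"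
proof (induction k)
  case 0
  then show ?case
    using h_poly_three_times_power_2[of i] by (simp add: w2_lead_def w2_below_def mult.commute)
next
  case (Suc k)
  let ?q = "2 ^ i :: nat"
  have "h_poly (?q * (2 * Suc k + 3)) =
      w2 ^ ?q * w3 ^ 0 * h_poly (?q * (2 * k + 3)) + w2 ^ 0 * w3 ^ ?q * h_poly (?q * (2 * k + 2))"
    using h_poly_frobenius[of "?q * (2 * k + 2)" i] by (simp add: algebra_simps)
  moreover have "w2_below (?q + ?q * k) (w2 ^ 0 * w3 ^ ?q * h_poly (?q * (2 * k + 2)))"
    unfolding w2_below_def
  proof
    fix x assume "x \<in> Poly_Mapping.keys (w2 ^ 0 * w3 ^ ?q * h_poly (?q * (2 * k + 2)))"
    then obtain y where y: "fst x = fst y" "y \<in> Poly_Mapping.keys (h_poly (?q * (2 * k + 2)))"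
      using keys_monomial_mult by fastforce
    then have "(fst y, snd y) \<in> Poly_Mapping.keys (h_poly (2 ^ Suc i * (k + 1)))"
      by (simp add: algebra_simps)
    from h_poly_keys[OF this] have "fst y + 3 * ?q \<le> ?q * (k + 1)" by simp
    moreover have "0 < ?q" by simp
    ultimately have "fst y < ?q * (k + 1)" by linarith
    then show "fst x < ?q + ?q * k" using y by simp
  qed
  ultimately show ?case
    using w2_lead_add[OF w2_lead_mult[OF Suc, of ?q 0]] by simp
qed

section \<open>The polynomials f\<close>

definition P_poly :: "nat \<Rightarrow> nat \<Rightarrow> nat \<Rightarrow> Z2_poly" where
  "P_poly n t k = h_poly (n + 1 - s_sum n t k + 2 ^ k)"

definition Q_poly :: "nat \<Rightarrow> nat \<Rightarrow> nat \<Rightarrow> Z2_poly" where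
  "Q_poly n t k = w3 ^ s_sum n t k * h_poly (n + 1 - s_sum n t k)"

section \<open>Partial sums of the binary digits\<close>

lemma \<alpha>_cases: "\<alpha> n t k = 0 \<or> \<alpha> n t k = 1"
  by (auto simp: \<alpha>_def)

lemma s_sum_0 [simp]: "s_sum n t 0 = 0"
  by (simp add: s_sum_def)

lemma s_sum_Suc: "s_sum n t (Suc k) = s_sum n t k + \<alpha> n t k * 2 ^ k"
  by (simp add: s_sum_def)

lemma s_sum_less: "s_sum n t k < 2 ^ k"
proof (induction k)
  case (Suc k)
  then show ?case using \<alpha>_cases[of n t k] by (auto simp: s_sum_Suc)
qed simp

lemma s_sum_dvd: "k \<le> l \<Longrightarrow> \<exists>q. s_sum n t l = s_sum n t k + 2 ^ k * q"
proof (induction l rule: dec_induct)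
  case base
  show ?case by (rule exI[of _ 0]) simp
next
  case (step l)
  then obtain q where "s_sum n t l = s_sum n t k + 2 ^ k * q" by blast
  moreover have "2 ^ l = 2 ^ k * (2 ^ (l - k) :: nat)"
    using step by (simp flip: power_add)
  ultimately have "s_sum n t (Suc l) = s_sum n t k + 2 ^ k * (q + \<alpha> n t l * 2 ^ (l - k))"
    by (simp add: s_sum_Suc algebra_simps)
  then show ?case by blast
qed

locale binary_range =
  fixes n t :: nat
  assumes t_ge: "3 \<le> t" and n_ge: "2 ^ t - 1 \<le> n" and n_less: "n < 2 ^ (t + 1) - 1"
begin

abbreviation "a \<equiv> \<alpha> n t"
abbreviation "S \<equiv> s_sum n t"
abbreviation "f \<equiv> f_poly n t"
abbreviation "P \<equiv> P_poly n t"
abbreviation "Q \<equiv> Q_poly n t"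

lemma s_sum_top: "n + 1 = 2 ^ t + S t"
  using binary_expansion[OF n_ge n_less] by (simp add: s_sum_def)

text \<open>The digits from position \<open>k\<close> on and the top power \<open>2^t\<close> are
  multiples of \<open>2^k\<close>; the latter makes the quotient positive.\<close>

lemma n_minus_s_sum:
  assumes "k \<le> t"
  obtains m where "0 < m" "n + 1 = S k + 2 ^ k * m"
proof -
  obtain q where q: "S t = S k + 2 ^ k * q" using s_sum_dvd[OF assms] by blast
  have "2 ^ t = 2 ^ k * (2 ^ (t - k) :: nat)"
    using assms by (simp flip: power_add)
  then have "n + 1 = S k + 2 ^ k * (2 ^ (t - k) + q)"
    using s_sum_top q by (simp add: algebra_simps)
  then show thesis by (intro that) simp_all
qed

lemma s_sum_bound: "k \<le> t \<Longrightarrow> S k + 8 \<le> n + 1"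
proof -
  assume "k \<le> t"
  then have "S k \<le> S t" using s_sum_dvd[of k t n t] by auto
  moreover have "(2::nat) ^ 3 \<le> 2 ^ t" using t_ge by (intro power_increasing) auto
  ultimately show ?thesis using s_sum_top by simp
qed

lemma f_poly_eq:
  assumes "k < t"
  shows "f k = w3 ^ (a k * S k) * h_poly (n + 1 - S (Suc k) + 2 ^ k)"
proof -
  have "n - 2 + 2 ^ k - S (Suc k) = n + 1 - S (Suc k) + 2 ^ k - 3"
    "\<not> n + 1 - S (Suc k) + 2 ^ k < 3"
    using s_sum_bound[of "Suc k"] assms by auto
  then show ?thesis by (simp add: f_poly_def h_poly_def)
qed

lemma f_poly_eq_P: "k < t \<Longrightarrow> a k = 0 \<Longrightarrow> f k = P k"
  by (simp add: f_poly_eq P_poly_def s_sum_Suc)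

lemma f_poly_eq_Q: "k < t \<Longrightarrow> a k = 1 \<Longrightarrow> f k = Q k"
  using s_sum_bound[of "Suc k"] by (simp add: f_poly_eq Q_poly_def s_sum_Suc)

text \<open>Subtracting the digit's \<open>2^k\<close> is offset by doubling the added power
  \<open>2^k\<close>.\<close>

lemma P_Suc: "k < t \<Longrightarrow> a k = 1 \<Longrightarrow> P (Suc k) = P k"
proof -
  assume "k < t" "a k = 1"
  then have "n + 1 - S (Suc k) + 2 ^ Suc k = n + 1 - S k + 2 ^ k"
    using s_sum_bound[of "Suc k"] by (simp add: s_sum_Suc)
  then show ?thesis by (simp only: P_poly_def)
qed

lemma Q_Suc: "a k = 0 \<Longrightarrow> Q (Suc k) = Q k"
  by (simp add: Q_poly_def s_sum_Suc)

lemma n_minus_s_sum_top: "n + 1 - S t = 2 ^ t"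
  using s_sum_top by simp

lemma P_top: "P t = 0"
  using h_poly_power_2[of "Suc t"] unfolding P_poly_def n_minus_s_sum_top by (simp add: mult_2)

lemma Q_top: "Q t = 0"
  unfolding Q_poly_def n_minus_s_sum_top h_poly_power_2 by simp

lemma P_cases: "k \<le> t \<Longrightarrow> P k = 0 \<or> (\<exists>j \<ge> k. j < t \<and> P k = f j)"
proof (induction k rule: inc_induct)
  case base
  then show ?case by (simp add: P_top)
next
  case (step k)
  then show ?case
    using \<alpha>_cases[of n t k] f_poly_eq_P[of k] P_Suc[of k] by (metis Suc_leD order_refl)
qed

lemma Q_cases: "k \<le> t \<Longrightarrow> Q k = 0 \<or> (\<exists>j \<ge> k. j < t \<and> Q k = f j)"
proof (induction k rule: inc_induct)
  case base
  then show ?case by (simp add: Q_top)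
next
  case (step k)
  then show ?case
    using \<alpha>_cases[of n t k] f_poly_eq_Q[of k] Q_Suc[of k] by (metis Suc_leD order_refl)
qed

section \<open>Syzygies between neighbouring \<open>f\<close>\<close>

text \<open>Ensures that \<open>w3 ^ (2^i - a i * S i)\<close> completes the prefactor of
  \<open>f i\<close> to \<open>w3 ^ (2^i)\<close>.\<close>

lemma digit_s_sum_le: "a i * S i \<le> 2 ^ i"
  using \<alpha>_cases[of n t i] s_sum_less[of n t i] by auto

text \<open>This is the Frobenius relation with stride \<open>2^i\<close> from
  \<open>n + 1 - S (Suc i) + 2^i\<close>, the argument in \<open>f i\<close>; the zero digit makes
  its other arguments those of \<open>f (Suc i)\<close> and \<open>P (Suc (Suc i))\<close>.\<close>

lemma syzygy_0:
  assumes "Suc i < t" "a (Suc i) = 0"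
  shows "w2 ^ (2 ^ i) * f (Suc i) = P (Suc (Suc i)) + w3 ^ (2 ^ i - a i * S i) * f i"
proof -
  let ?q = "2 ^ i :: nat"
  define X where "X = n + 1 - S (Suc i)"
  have "w3 ^ (?q - a i * S i) * f i = w3 ^ ?q * h_poly (X + ?q)"
    using assms digit_s_sum_le[of i] by (simp add: f_poly_eq X_def flip: mult.assoc power_add)
  moreover have "f (Suc i) = h_poly (X + ?q + ?q)"
    using assms by (simp add: f_poly_eq_P P_poly_def X_def mult_2 add.assoc)
  moreover have "P (Suc (Suc i)) = h_poly (X + ?q + 3 * ?q)"
    using assms by (simp add: P_poly_def X_def s_sum_Suc[of n t "Suc i"] ac_simps)
  ultimately show ?thesis
    using h_poly_frobenius[of "X + ?q" i] by (simp add: add.assoc)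
qed

text \<open>\<open>h_poly\<close> at \<open>n + 1 - S (Suc i) + 2^(i+2)\<close> is expanded twice,
  with strides \<open>2^i\<close> and \<open>2^(i+1)\<close>. The two expansions are equated and
  multiplied by \<open>w3 ^ S (Suc i)\<close>.\<close>

lemma syzygy_1:
  assumes "Suc i < t" "a (Suc i) = 1"
  shows "w2 ^ (2 ^ Suc i) * f (Suc i) = w3 ^ S (Suc i) * (w2 ^ (2 ^ i) * P (Suc (Suc i)))
      + w3 ^ (S (Suc i) + (2 ^ i - a i * S i)) * f i + Q (Suc (Suc i))"
proof -
  let ?q = "2 ^ i :: nat"
  define X where "X = n + 1 - S (Suc i)"
  define Y where "Y = n + 1 - S (Suc (Suc i))"
  have S: "S (Suc (Suc i)) = S (Suc i) + 2 * ?q"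
    using assms by (simp add: s_sum_Suc[of n t "Suc i"])
  then have XY: "X = Y + 2 * ?q" "0 < Y"
    using s_sum_bound[of "Suc (Suc i)"] assms by (auto simp: X_def Y_def)
  have "w3 ^ (?q - a i * S i) * f i = w3 ^ ?q * h_poly (X + ?q)"
    using assms digit_s_sum_le[of i] by (simp add: f_poly_eq X_def flip: mult.assoc power_add)
  moreover have "f (Suc i) = w3 ^ S (Suc i) * h_poly X"
    using assms by (simp add: f_poly_eq_Q Q_poly_def X_def)
  moreover have "P (Suc (Suc i)) = h_poly (X + ?q + ?q)"
    unfolding P_poly_def Y_def[symmetric] XY(1) by (simp add: ac_simps)
  moreover have "Q (Suc (Suc i)) = w3 ^ S (Suc i) * (w3 ^ (2 * ?q) * h_poly Y)"
    unfolding Q_poly_def Y_def[symmetric] unfolding S by (simp add: power_add mult.assoc)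
  moreover have "h_poly (X + ?q + 3 * ?q) =
      w2 ^ ?q * h_poly (X + ?q + ?q) + w3 ^ ?q * h_poly (X + ?q)"
    by (rule h_poly_frobenius) (simp add: XY)
  moreover have "h_poly (X + ?q + 3 * ?q) = w2 ^ (2 * ?q) * h_poly X + w3 ^ (2 * ?q) * h_poly Y"
    using h_poly_frobenius[OF XY(2), of "Suc i"] by (simp add: XY(1) add.assoc)
  ultimately have "w2 ^ (2 * ?q) * h_poly X + w3 ^ (2 * ?q) * h_poly Y
      = w2 ^ ?q * P (Suc (Suc i)) + w3 ^ (?q - a i * S i) * f i"
    by simp
  then have "w2 ^ (2 * ?q) * h_poly X
      = w2 ^ ?q * P (Suc (Suc i)) + w3 ^ (?q - a i * S i) * f i + w3 ^ (2 * ?q) * h_poly Y"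
    by (metis Z2_poly_add_self_left add.commute)
  then have "w3 ^ S (Suc i) * (w2 ^ (2 * ?q) * h_poly X)
      = w3 ^ S (Suc i) * (w2 ^ ?q * P (Suc (Suc i)) + w3 ^ (?q - a i * S i) * f i
        + w3 ^ (2 * ?q) * h_poly Y)"
    by simp
  moreover note \<open>f (Suc i) = _\<close> \<open>Q (Suc (Suc i)) = _\<close>
  ultimately show ?thesis
    by (simp add: distrib_left power_add ac_simps)
qed

section \<open>Corners of the staircase\<close>

text \<open>For \<open>i < t\<close> this is the exponent of \<open>w2\<close> in the leading
  monomial of \<open>f i\<close>.\<close>

definition B :: "nat \<Rightarrow> nat" where
  "B i = (n + 1 - S (Suc i)) div 2 - 2 ^ i"

text \<open>With \<open>n + 1 - S (Suc i) = 2^(i+1) * (l + 1)\<close>, the argument of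
  \<open>h_poly\<close> in \<open>f i\<close> is the odd multiple \<open>2^i * (2 * l + 3)\<close>.
  The first equation determines \<open>B i\<close> without division or truncated
  subtraction.\<close>

lemma B_lead:
  assumes "i < t"
  shows "2 * B i + 2 ^ Suc i + S (Suc i) = n + 1" (is ?eq)
    and "w2_lead (f i) (B i) (a i * S i + (2 ^ i - 1))" (is ?lead)
proof -
  obtain m where m: "0 < m" "n + 1 = S (Suc i) + 2 ^ Suc i * m"
    using n_minus_s_sum[of "Suc i"] assms by auto
  then obtain l where l: "m = Suc l" by (cases m) auto
  have B: "B i = 2 ^ i * l"
    using m(2) by (simp add: B_def l)
  then show ?eq using m(2) by (simp add: l)
  have "n + 1 - S (Suc i) + 2 ^ i = 2 ^ i * (2 * l + 3)"
    using m(2) by (simp add: l algebra_simps)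
  then have "f i = w2 ^ 0 * w3 ^ (a i * S i) * h_poly (2 ^ i * (2 * l + 3))"
    using f_poly_eq[OF assms] by simp
  with w2_lead_mult[OF h_poly_lead[of i l], of 0 "a i * S i"] B show ?lead by simp
qed

text \<open>The gap between the corners is the exponent of \<open>w2\<close> on the left of
  \<open>syzygy_0\<close> or \<open>syzygy_1\<close>, according to the digit.\<close>

lemma B_diff:
  assumes "Suc i < t"
  shows "B i = B (Suc i) + 2 ^ i * (1 + a (Suc i))"
  using B_lead(1)[of i] B_lead(1)[of "Suc i"] assms
  by (simp add: s_sum_Suc[of n t "Suc i"] algebra_simps)

lemma in_stair_dom:
  assumes "j < t" "\<And>i. j = Suc i \<Longrightarrow> b < 2 ^ i"
  shows "(j, b, c) \<in> stair_dom B (t - 1)"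
proof (cases j)
  case (Suc i)
  have "B j + b < B i"
    using B_diff[of i] assms Suc by (simp add: algebra_simps trans_less_add1)
  then show ?thesis using assms Suc by (simp add: stair_dom_def)
qed (use assms in \<open>simp add: stair_dom_def\<close>)

lemma in_stair_span:
  assumes "j < t" "\<And>i. j = Suc i \<Longrightarrow> b < 2 ^ i"
  shows "w3 ^ c * (w2 ^ b * f j) \<in> stair_span f B (t - 1)"
  using stair_span_base[OF in_stair_dom[OF assms], of f c]
  by (simp add: stair_term_def ac_simps)

sublocale staircase f B "\<lambda>i. a i * S i + (2 ^ i - 1)" "t - 1"
proof
  fix i assume "i \<le> t - 1"
  then show "w2_lead (f i) (B i) (a i * S i + (2 ^ i - 1))"
    using t_ge by (intro B_lead) simp
next
  fix i assume "i < t - 1"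
  then have i: "Suc i < t" by simp
  let ?M = "stair_span f B (t - 1)"
  show "B (Suc i) < B i" using B_diff[OF i] by simp
  have fi: "w3 ^ c * f i \<in> ?M" for c
    using in_stair_span[of i 0 c] i by simp
  \<comment> \<open>The factor \<open>w2 ^ (2^i)\<close> in \<open>syzygy_1\<close> is admissible: a
    nonzero \<open>P (Suc (Suc i))\<close> is some \<open>f j\<close> with
    \<open>j \<ge> i + 2\<close>, whose band has width at least \<open>2^(j-1)\<close>, more than
    \<open>2^i\<close>.\<close>
  have P: "w3 ^ c * (w2 ^ b * P (Suc (Suc i))) \<in> ?M" if "b \<le> 2 ^ i" for b c
  proof -
    from P_cases[of "Suc (Suc i)"] i
    consider "P (Suc (Suc i)) = 0" | j where "Suc (Suc i) \<le> j" "j < t" "P (Suc (Suc i)) = f j"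
      by auto
    then show ?thesis
    proof cases
      case 2
      have "b < 2 ^ l" if "j = Suc l" for l
      proof -
        have "(2::nat) ^ Suc i \<le> 2 ^ l"
          using 2 that by (intro power_increasing) auto
        moreover have "(0::nat) < 2 ^ i" by simp
        ultimately show ?thesis using \<open>b \<le> 2 ^ i\<close> unfolding power_Suc by linarith
      qed
      with 2 show ?thesis using in_stair_span[of j b c] by simp
    qed (simp add: stair_span_0)
  qed
  have Q: "Q (Suc (Suc i)) \<in> ?M"
    using Q_cases[of "Suc (Suc i)"] i in_stair_span[of _ 0 0] by (auto simp: stair_span_0)
  show "w2 ^ (B i - B (Suc i)) * f (Suc i) \<in> ?M"
  proof (cases "a (Suc i) = 0")
    case True
    have "w2 ^ (B i - B (Suc i)) * f (Suc i) = w2 ^ (2 ^ i) * f (Suc i)"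
      using B_diff[OF i] True by simp
    with syzygy_0[OF i True] fi P[of 0 0] show ?thesis
      by (auto intro: stair_span_add)
  next
    case False
    then have a: "a (Suc i) = 1" using \<alpha>_cases[of n t "Suc i"] by simp
    have "w2 ^ (B i - B (Suc i)) * f (Suc i) = w2 ^ (2 ^ Suc i) * f (Suc i)"
      using B_diff[OF i] a by (simp add: mult_2)
    with syzygy_1[OF i a] fi P[of "2 ^ i"] Q show ?thesis
      by (auto intro!: stair_span_add)
  qed
qed

section \<open>Equality of the two ideals\<close>

lemma generators: "P 0 = g_poly (n - 1)" "Q 0 = g_poly (n - 2)"
  using s_sum_bound[of 0] by (simp_all add: P_poly_def Q_poly_def h_poly_def)

lemma generator_0: "a 0 = 0 \<Longrightarrow> P 1 = g_poly n"
  using s_sum_bound[of 0] by (simp add: P_poly_def h_poly_def s_sum_Suc)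

text \<open>The defining recurrence of \<open>g_poly n\<close>, as \<open>Q 1\<close> is
  \<open>w3 * h_poly n\<close> for lowest digit 1.\<close>

lemma generator_1: "a 0 = 1 \<Longrightarrow> g_poly n = w2 * Q 0 + Q 1"
  using s_sum_bound[of 0] h_poly_rec[of n]
  by (simp add: Q_poly_def h_poly_def[of "n + 3"] s_sum_Suc)

lemma ideal_eq:
  "ideal_gen {g_poly (n - 2), g_poly (n - 1), g_poly n} = ideal_gen (f ` {..t - 1})"
    (is "?I = ?J")
proof
  have add: "p + q \<in> ideal_gen G" if "p \<in> ideal_gen G" "q \<in> ideal_gen G"
    for p q and G :: "Z2_poly set"
    using that unfolding ideal_gen_def by (rule module.span_add[OF module_times])
  have mult: "r * p \<in> ideal_gen G" if "p \<in> ideal_gen G" for r p and G :: "Z2_poly set"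
    using that unfolding ideal_gen_def by (rule module.span_scale[OF module_times])
  have base: "p \<in> ideal_gen G" if "p \<in> G" for p and G :: "Z2_poly set"
    using that unfolding ideal_gen_def by (rule module.span_base[OF module_times])
  have zero: "0 \<in> ideal_gen G" for G :: "Z2_poly set"
    unfolding ideal_gen_def by (rule module.span_zero[OF module_times])
  have least: "ideal_gen G \<subseteq> ideal_gen H" if "G \<subseteq> ideal_gen H" for G H :: "Z2_poly set"
    using that unfolding ideal_gen_def
    by (intro module.span_minimal[OF module_times] module.subspace_span[OF module_times])
  have gens: "P 0 \<in> ?I" "Q 0 \<in> ?I" "g_poly n \<in> ?I"
    by (auto simp: generators intro: base)
  \<comment> \<open>\<open>P\<close> and \<open>Q\<close> are carried along because the next
    \<open>f\<close> is one of them; the syzygies are solved for the new member of the following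
    pair.\<close>
  have "f k \<in> ?I \<and> P (Suc k) \<in> ?I \<and> Q (Suc k) \<in> ?I" if "k < t" for k
    using that
  proof (induction k)
    case 0
    from \<alpha>_cases[of n t 0] show ?case
    proof
      assume "a 0 = 0"
      then show ?thesis
        using \<open>0 < t\<close> gens generator_0 f_poly_eq_P[of 0] Q_Suc[of 0] by simp
    next
      assume a: "a 0 = 1"
      then have "Q 1 = w2 * Q 0 + g_poly n"
        using generator_1 by (metis Z2_poly_add_self_left)
      then have "Q 1 \<in> ?I" using gens by (auto intro: add mult)
      with a show ?thesis
        using \<open>0 < t\<close> gens f_poly_eq_Q[of 0] P_Suc[of 0] by simp
    qed
  next
    case (Suc k)
    then have IH: "f k \<in> ?I" "P (Suc k) \<in> ?I" "Q (Suc k) \<in> ?I" by auto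
    from \<alpha>_cases[of n t "Suc k"] show ?case
    proof
      assume a: "a (Suc k) = 0"
      have f: "f (Suc k) \<in> ?I" using f_poly_eq_P[OF Suc.prems a] IH by simp
      have "P (Suc (Suc k)) = w2 ^ (2 ^ k) * f (Suc k) + w3 ^ (2 ^ k - a k * S k) * f k"
        using syzygy_0[OF Suc.prems a] by (simp add: add.assoc)
      then have "P (Suc (Suc k)) \<in> ?I" using IH f by (auto intro: add mult)
      with f IH Q_Suc[OF a] show ?thesis by simp
    next
      assume a: "a (Suc k) = 1"
      have f: "f (Suc k) \<in> ?I" using f_poly_eq_Q[OF Suc.prems a] IH by simp
      have P: "P (Suc (Suc k)) \<in> ?I" using P_Suc[OF Suc.prems a] IH by simp
      have "Q (Suc (Suc k)) = w2 ^ (2 ^ Suc k) * f (Suc k)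
          + (w3 ^ S (Suc k) * (w2 ^ (2 ^ k) * P (Suc (Suc k)))
          + w3 ^ (S (Suc k) + (2 ^ k - a k * S k)) * f k)"
        unfolding syzygy_1[OF Suc.prems a] by (simp add: ac_simps)
      also have "\<dots> \<in> ?I" using IH f P by (auto intro!: add mult)
      finally show ?thesis using f P by simp
    qed
  qed
  then show "?J \<subseteq> ?I" using t_ge by (intro least) auto
  have f: "f k \<in> ?J" if "k < t" for k
    using that by (intro base) auto
  have PQ: "P k \<in> ?J" "Q k \<in> ?J" if "k \<le> t" for k
    using P_cases[OF that] Q_cases[OF that] f zero by auto
  \<comment> \<open>By the lowest digit, \<open>g_poly n\<close> is \<open>P 1\<close> or
    \<open>w2 * Q 0 + Q 1\<close>.\<close>
  have "g_poly n \<in> ?J"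
    using \<alpha>_cases[of n t 0] generator_0 generator_1 PQ[of 0] PQ[of 1] t_ge
    by (auto intro!: add mult)
  then show "?I \<subseteq> ?J"
    using PQ[of 0] by (intro least) (auto simp: generators)
qed

end

theorem theorem3p14:
  fixes n t :: nat
  assumes "n \<ge> 7" and "t \<ge> 3"
    and "2 ^ t - 1 \<le> n" and "n < 2 ^ (t + 1) - 1"
  shows "is_groebner_basis {f_poly n t i |i. i \<le> t - 1} (ideal_gen {g_poly (n - 2), g_poly (n - 1), g_poly n})"
proof -
  interpret binary_range n t
    by unfold_locales (use assms in auto)
  have "{f_poly n t i |i. i \<le> t - 1} = f ` {..t - 1}"
    by auto
  then show ?thesis using groebner ideal_eq by simp
qed

end
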